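(* Fix a dimension $n$ and an even degree $d$. Let $\mathcal{D}^m$ ($m=1,2,\ldots$) be any family of algebraic disjunctions of $\mathbb{R}^n$ such that (a) for every positive definite form $p\in H_{n,d}$ there is some $m$ with $p\in\mathbf{\Sigma}_{n,d}^{d}(\mathcal{D}^m)$, and (b) for every $m$, each subset in $\mathcal{D}^m$ contains exactly one polynomial, which is a form of degree at most $d$. Let $\widehat K_{n,d}^0:=\widehat{\mathbf{\Sigma}}_{n,d}$, and for each integer $i\ge1$ let $$\widehat K_{n,d}^i:=\bigcup_{m=1}^i\mathbf{\Sigma}_{n,d}^d(\mathcal{D}^m).$$ Then the sequence $K^i_{n,d}:=\widehat K_{n,d}^i\cap H_{n,d}$, $i=0,1,2,\ldots$, satisfies the following properties: (1) $K_{n,d}^i\subseteq\widehat P_{n,d}$ for all $i$, and there exists a positive definite form $s_{n,d}\in K_{n,d}^0$; (2) if $p\in H_{n,d}$ is positive definite, then there exists an integer $i$ such that $p\in K_{n,d}^i$; (3) $K_{n,d}^i\subseteq K_{n,d}^{i+1}$ for all $i$; (4) if $p\in K_{n,d}^i$, then $p+\epsilon s_{n,d}\in K_{n,d}^i$ for all $\epsilon\in[0,1]$, where $s_{n,d}$ is the positive definite form in (1).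
   Context: A form is a homogeneous polynomial with real coefficients. $H_{n,d}$, $\widehat P_{n,d}$ and $\widehat{\mathbf{\Sigma}}_{n,d}$ denote, respectively, the sets of forms, of forms that are nonnegative on $\mathbb{R}^n$, and of sum of squares forms, in $n$ variables and of degree $d$. A polynomial is a sum of squares (sos) if it is a finite sum of squares of real polynomials. A form $p$ in $n$ variables is positive definite if $p(x)>0$ for all $x\in\mathbb{R}^n$, $x\ne0$. Algebraic disjunction: let $r,n_1,\ldots,n_r$ be positive integers. A collection of sets of real polynomials in $n$ variables $\mathcal{D}=\{\{q_{k,j}\}_{j=1,\ldots,n_k},\ k=1,\ldots,r\}$ is an algebraic disjunction of $\mathbb{R}^n$ if $\mathbb{R}^n=\bigcup_{k=1}^r\Omega_k$, where $\Omega_k=\{x\in\mathbb{R}^n\mid q_{k,j}(x)\ge 0,\ j=1,\ldots,n_k\}$. The sets $\{q_{k,j}\}_{j=1,\ldots,n_k}$ are called the subsets in $\mathcal{D}$. For an algebraic disjunction $\mathcal{D}=\{\{q_{k,j}\}_{j=1,\ldots,n_k},\ k=1,\ldots,r\}$ of $\mathbb{R}^n$ and an integer $\bar d\ge d$, $\mathbf{\Sigma}_{n,d}^{\bar d}(\mathcal{D})$ is the set of real polynomials $p$ in $n$ variables of degree at most $d$ for which there exist sos polynomials $s_{k,j}$ ($k=1,\ldots,r$, $j=0,1,\ldots,n_k$) such that for every $k=1,\ldots,r$, $p(x)=s_{k,0}(x)+\sum_{j=1}^{n_k}s_{k,j}(x)q_{k,j}(x)$, with $\deg s_{k,0}\le\bar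 d$ and $\deg(s_{k,j}q_{k,j})\le\bar d$ for all $j=1,\ldots,n_k$. *)

theory Defs
  imports "HOL-Analysis.Analysis" "HOL-Library.Poly_Mapping"
begin

text \<open>
  The index type \<open>'n\<close> names the variables, so the number of variables is \<open>CARD('n)\<close> and
  polynomials are functions on \<open>real^'n\<close>. A polynomial maps exponent vectors to coefficients;
  the ring operations are those of \<^theory>\<open>HOL-Library.Poly_Mapping\<close> (convolution product).
\<close>

type_synonym 'n rpoly = "('n \<Rightarrow>\<^sub>0 nat) \<Rightarrow>\<^sub>0 real"

definition peval :: "'n::finite rpoly \<Rightarrow> real^'n \<Rightarrow> real" where
  "peval p x = (\<Sum>m\<in>Poly_Mapping.keys p. Poly_Mapping.lookup p m *
      (\<Prod>i\<in>UNIV. (x $ i) ^ Poly_Mapping.lookup m i))"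

definition pconst :: "real \<Rightarrow> 'n rpoly" where
  "pconst c = Poly_Mapping.single 0 c"

definition mon_deg :: "('n::finite \<Rightarrow>\<^sub>0 nat) \<Rightarrow> nat" where
  "mon_deg m = (\<Sum>i\<in>UNIV. Poly_Mapping.lookup m i)"

text \<open>The zero polynomial gets degree 0; only upper bounds on degrees are used below.\<close>

definition pdeg :: "'n::finite rpoly \<Rightarrow> nat" where
  "pdeg p = Max (insert 0 (mon_deg ` Poly_Mapping.keys p))"

text \<open>The zero polynomial belongs to \<open>forms d\<close> for every \<open>d\<close>.\<close>

definition forms :: "nat \<Rightarrow> 'n::finite rpoly set" where
  "forms d = {p. \<forall>m\<in>Poly_Mapping.keys p. mon_deg m = d}"

definition sos :: "'n rpoly \<Rightarrow> bool" where
  "sos p \<longleftrightarrow> (\<exists>gs. p = (\<Sum>g\<leftarrow>gs. g ^ 2))"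

definition nonneg_forms :: "nat \<Rightarrow> 'n::finite rpoly set" where
  "nonneg_forms d = {p \<in> forms d. \<forall>x. peval p x \<ge> 0}"

definition sos_forms :: "nat \<Rightarrow> 'n::finite rpoly set" where
  "sos_forms d = {p \<in> forms d. sos p}"

definition positive_definite :: "'n::finite rpoly \<Rightarrow> bool" where
  "positive_definite p \<longleftrightarrow> (\<forall>x. x \<noteq> 0 \<longrightarrow> peval p x > 0)"

definition semialg :: "'n::finite rpoly list \<Rightarrow> (real^'n) set" where
  "semialg Q = {x. \<forall>j<length Q. peval (Q ! j) x \<ge> 0}"

text \<open>
  A disjunction is the indexed family \<open>q\<^sub>k\<^sub>,\<^sub>j = D ! k ! j\<close>, both indices starting at 0; thus
  \<open>r = length D\<close>, \<open>n\<^sub>k = length (D ! k)\<close>, and the subset with index \<open>k\<close> is \<open>set (D ! k)\<close>.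
\<close>

definition algebraic_disjunction :: "'n::finite rpoly list list \<Rightarrow> bool" where
  "algebraic_disjunction D \<longleftrightarrow>
     length D > 0 \<and> (\<forall>k<length D. length (D ! k) > 0) \<and>
     (\<Union>k<length D. semialg (D ! k)) = UNIV"

text \<open>The multiplier \<open>s\<^sub>k\<^sub>,\<^sub>0\<close> is \<open>s0 k\<close>; \<open>s k j\<close> is the multiplier of \<open>D ! k ! j\<close>.\<close>

definition Sigma_disj :: "nat \<Rightarrow> nat \<Rightarrow> 'n::finite rpoly list list \<Rightarrow> 'n rpoly set" where
  "Sigma_disj d dbar D = {p. pdeg p \<le> d \<and>
     (\<exists>s0 s. \<forall>k<length D.
        sos (s0 k) \<and> (\<forall>j<length (D ! k). sos (s k j)) \<and>
        p = s0 k + (\<Sum>j<length (D ! k). s k j * D ! k ! j) \<and>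
        pdeg (s0 k) \<le> dbar \<and>
        (\<forall>j<length (D ! k). pdeg (s k j * D ! k ! j) \<le> dbar))}"

definition Khat :: "nat \<Rightarrow> (nat \<Rightarrow> 'n::finite rpoly list list) \<Rightarrow> nat \<Rightarrow> 'n rpoly set" where
  "Khat d D i = (if i = 0 then sos_forms d else (\<Union>m\<in>{1..i}. Sigma_disj d d (D m)))"

definition K :: "nat \<Rightarrow> (nat \<Rightarrow> 'n::finite rpoly list list) \<Rightarrow> nat \<Rightarrow> 'n rpoly set" where
  "K d D i = Khat d D i \<inter> forms d"

end

theory Submission
  imports Defs
begin

text \<open>
  Nonnegativity, monotonicity and stability are read off the certificates
  \<open>p = s\<^sub>k\<^sub>,\<^sub>0 + \<Sum>\<^sub>j s\<^sub>k\<^sub>,\<^sub>j q\<^sub>k\<^sub>,\<^sub>j\<close>. A point of \<open>\<real>\<^sup>n\<close> lies in some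
  \<open>\<Omega>\<^sub>k\<close>, and there the \<open>k\<close>-th representation is visibly nonnegative (\<open>Sigma_disj_nonneg\<close>). An sos
  polynomial of degree at most \<open>d\<close> may be taken as \<open>s\<^sub>k\<^sub>,\<^sub>0\<close>, with all other multipliers zero, and may
  likewise be added to the \<open>s\<^sub>k\<^sub>,\<^sub>0\<close> of an existing certificate (\<open>sos_in_Sigma_disj\<close>,
  \<open>Sigma_disj_add_sos\<close>). The first remark gives \<open>K\<^sup>0 \<subseteq> K\<^sup>1\<close>, the one inclusion between consecutive sets
  that is not an inclusion of unions; the second gives stability under adding \<open>\<epsilon> s\<close> for any sos form \<open>s\<close>
  of degree \<open>d\<close>. A suitable \<open>s\<close> is \<open>x\<^sub>1\<^sup>d + \<dots> + x\<^sub>n\<^sup>d\<close>, a positive definite sum of squares because \<open>d\<close> is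
  even. Reaching every positive definite form is exactly the covering hypothesis on the family.
\<close>

section \<open>Evaluation is a ring homomorphism\<close>

lemma peval_add: "peval (p + q) x = peval p x + peval q x"
  unfolding peval_def by (rule setsum_keys_plus_distrib) (simp_all add: algebra_simps)

lemma peval_zero: "peval 0 x = 0"
  by (simp add: peval_def)

lemma peval_sum: "peval (\<Sum>i\<in>A. f i) x = (\<Sum>i\<in>A. peval (f i) x)"
  by (induction A rule: infinite_finite_induct) (simp_all add: peval_add peval_zero)

lemma peval_single:
  "peval (Poly_Mapping.single m c) x = c * (\<Prod>i\<in>UNIV. (x $ i) ^ Poly_Mapping.lookup m i)"
  by (simp add: peval_def)

lemma poly_mapping_eq_sum_single:
  fixes p :: "'a \<Rightarrow>\<^sub>0 'b::comm_monoid_add"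
  shows "p = (\<Sum>m\<in>Poly_Mapping.keys p. Poly_Mapping.single m (Poly_Mapping.lookup p m))"
  by (rule poly_mapping_eqI)
    (auto simp: lookup_sum lookup_single when_def in_keys_iff)

text \<open>Both sides are bilinear, so it suffices to compare them on monomials, where the claim is
  \<open>x\<^sup>m\<^sup>+\<^sup>m\<^sup>' = x\<^sup>m x\<^sup>m\<^sup>'\<close>.\<close>

lemma peval_mult: "peval (p * q) x = peval p x * peval q x"
proof -
  have monomials: "peval (Poly_Mapping.single m c * Poly_Mapping.single m' c') x =
      peval (Poly_Mapping.single m c) x * peval (Poly_Mapping.single m' c') x" for m m' c c'
    by (simp add: mult_single peval_single lookup_add power_add prod.distrib)
  let ?P = "\<lambda>p m. Poly_Mapping.single m (Poly_Mapping.lookup p m)"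
  have "peval ((\<Sum>m\<in>Poly_Mapping.keys p. ?P p m) * (\<Sum>m\<in>Poly_Mapping.keys q. ?P q m)) x =
      peval (\<Sum>m\<in>Poly_Mapping.keys p. ?P p m) x * peval (\<Sum>m\<in>Poly_Mapping.keys q. ?P q m) x"
    by (simp add: sum_product peval_sum monomials)
  then show ?thesis
    by (simp flip: poly_mapping_eq_sum_single)
qed

section \<open>Degrees and forms\<close>

lemma pdeg_le_iff: "pdeg p \<le> d \<longleftrightarrow> (\<forall>m\<in>Poly_Mapping.keys p. mon_deg m \<le> d)"
  by (auto simp: pdeg_def)

lemma pdeg_zero: "pdeg 0 = 0"
  by (simp add: pdeg_def)

lemma pdeg_add_le: "pdeg p \<le> d \<Longrightarrow> pdeg q \<le> d \<Longrightarrow> pdeg (p + q) \<le> d"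
  using keys_add[of p q] by (auto simp: pdeg_le_iff)

lemma pdeg_le_of_form: "p \<in> forms d \<Longrightarrow> pdeg p \<le> d"
  by (auto simp: forms_def pdeg_le_iff)

lemma forms_add: "p \<in> forms d \<Longrightarrow> q \<in> forms d \<Longrightarrow> p + q \<in> forms d"
  using keys_add[of p q] by (auto simp: forms_def)

lemma forms_sum: "(\<And>i. i \<in> A \<Longrightarrow> f i \<in> forms d) \<Longrightarrow> (\<Sum>i\<in>A. f i) \<in> forms d"
  by (induction A rule: infinite_finite_induct) (simp_all add: forms_add, simp_all add: forms_def)

lemma forms_pconst_mult: "p \<in> forms d \<Longrightarrow> pconst c * p \<in> forms d"
  using keys_mult[of "pconst c" p] by (auto simp: forms_def pconst_def split: if_splits)

section \<open>Sums of squares\<close>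

lemma sos_power2: "sos (g ^ 2)"
  unfolding sos_def by (rule exI[of _ "[g]"]) simp

lemma sos_zero: "sos 0"
  unfolding sos_def by (rule exI[of _ "[]"]) simp

lemma sos_add:
  assumes "sos p" and "sos q"
  shows "sos (p + q)"
proof -
  obtain gs hs where "p = (\<Sum>g\<leftarrow>gs. g ^ 2)" and "q = (\<Sum>g\<leftarrow>hs. g ^ 2)"
    using assms by (auto simp: sos_def)
  then have "p + q = (\<Sum>g\<leftarrow>gs @ hs. g ^ 2)" by simp
  then show ?thesis unfolding sos_def by blast
qed

lemma sos_sum: "(\<And>i. i \<in> A \<Longrightarrow> sos (f i)) \<Longrightarrow> sos (\<Sum>i\<in>A. f i)"
  by (induction A rule: infinite_finite_induct) (simp_all add: sos_zero sos_add)

lemma sos_pconst_mult: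
  assumes "c \<ge> 0" and "sos p"
  shows "sos (pconst c * p)"
proof -
  obtain gs where "p = (\<Sum>g\<leftarrow>gs. g ^ 2)" using assms(2) by (auto simp: sos_def)
  moreover have "pconst c = (pconst (sqrt c) :: 'a rpoly) ^ 2"
    using assms(1) by (simp add: pconst_def power2_eq_square mult_single)
  ultimately have "pconst c * p = (\<Sum>h\<leftarrow>map (\<lambda>g. pconst (sqrt c) * g) gs. h ^ 2)"
    by (simp add: sum_list_const_mult power_mult_distrib o_def)
  then show ?thesis unfolding sos_def by blast
qed

lemma peval_sos_nonneg:
  assumes "sos p"
  shows "peval p x \<ge> 0"
proof -
  have "peval (\<Sum>g\<leftarrow>gs. g ^ 2) x \<ge> 0" for gs
    by (induction gs) (simp_all add: peval_zero peval_add power2_eq_square peval_mult)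
  then show ?thesis using assms by (auto simp: sos_def)
qed

section \<open>The sum of the pure powers\<close>

definition pure_power_sum :: "nat \<Rightarrow> 'n::finite rpoly" where
  "pure_power_sum d = (\<Sum>i\<in>UNIV. Poly_Mapping.single (Poly_Mapping.single i d) 1)"

lemma pure_power_sum_form: "pure_power_sum d \<in> forms d"
  unfolding pure_power_sum_def
  by (rule forms_sum) (simp add: forms_def mon_deg_def lookup_single when_def)

text \<open>Since \<open>d\<close> is even, each summand is the square of \<open>x\<^sub>i\<close> raised to the power \<open>d / 2\<close>.\<close>

lemma sos_pure_power_sum:
  assumes "even d"
  shows "sos (pure_power_sum d :: 'n::finite rpoly)"
  unfolding pure_power_sum_def
proof (rule sos_sum)
  fix i :: 'n
  have "Poly_Mapping.single (Poly_Mapping.single i d) (1::real) =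
      (Poly_Mapping.single (Poly_Mapping.single i (d div 2)) 1) ^ 2"
    using assms by (simp add: power2_eq_square mult_single flip: single_add)
       (metis mult_2 dvd_mult_div_cancel)
  then show "sos (Poly_Mapping.single (Poly_Mapping.single i d) (1::real))"
    by (simp add: sos_power2)
qed

lemma peval_pure_power_sum: "peval (pure_power_sum d) x = (\<Sum>i\<in>UNIV. (x $ i) ^ d)"
proof -
  have "(\<Prod>j\<in>UNIV. (x $ j) ^ Poly_Mapping.lookup (Poly_Mapping.single i d) j) = (x $ i) ^ d" for i
  proof -
    have "(\<Prod>j\<in>UNIV. (x $ j) ^ Poly_Mapping.lookup (Poly_Mapping.single i d) j) =
        (\<Prod>j\<in>UNIV. if i = j then (x $ j) ^ d else 1)"
      by (rule prod.cong) (auto simp: lookup_single when_def)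
    then show ?thesis by simp
  qed
  then show ?thesis by (simp add: pure_power_sum_def peval_sum peval_single)
qed

text \<open>A coordinate \<open>x\<^sub>i \<noteq> 0\<close> contributes a positive term, the others nonnegative ones. For \<open>d = 0\<close> the
  polynomial is the constant \<open>n\<close>, covered by the same argument since \<open>0 ^ 0 = 1\<close>.\<close>

lemma positive_definite_pure_power_sum:
  assumes "even d"
  shows "positive_definite (pure_power_sum d)"
  unfolding positive_definite_def
proof (intro allI impI)
  fix x :: "real^'n"
  assume "x \<noteq> 0"
  then obtain i where "x $ i \<noteq> 0" by (auto simp: vec_eq_iff)
  then have "(x $ i) ^ d > 0" using assms by (simp add: zero_less_power_eq)
  then have "(\<Sum>i\<in>UNIV. (x $ i) ^ d) > 0"
    using assms by (intro sum_pos2[of _ i]) (auto simp: zero_le_even_power)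
  then show "peval (pure_power_sum d) x > 0" by (simp add: peval_pure_power_sum)
qed

section \<open>Certificates over an algebraic disjunction\<close>

text \<open>The representation to evaluate at \<open>x\<close> is one whose region \<open>\<Omega>\<^sub>k\<close> contains \<open>x\<close>: there every term is
  a product of nonnegative numbers.\<close>

lemma Sigma_disj_nonneg:
  assumes "algebraic_disjunction D" and "p \<in> Sigma_disj d e D"
  shows "peval p x \<ge> 0"
proof -
  obtain k where k: "k < length D" and x: "x \<in> semialg (D ! k)"
    using assms(1) unfolding algebraic_disjunction_def by blast
  obtain s0 s where "sos (s0 k)" and s: "\<forall>j<length (D ! k). sos (s k j)"
    and "p = s0 k + (\<Sum>j<length (D ! k). s k j * D ! k ! j)"
    using assms(2) k unfolding Sigma_disj_def by blast
  then have "peval p x =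
      peval (s0 k) x + (\<Sum>j<length (D ! k). peval (s k j) x * peval (D ! k ! j) x)"
    by (simp add: peval_add peval_sum peval_mult)
  also have "\<dots> \<ge> 0"
    using \<open>sos (s0 k)\<close> s x
    by (intro add_nonneg_nonneg sum_nonneg mult_nonneg_nonneg)
      (auto simp: peval_sos_nonneg semialg_def)
  finally show ?thesis .
qed

text \<open>The free multiplier \<open>s\<^sub>k\<^sub>,\<^sub>0\<close> of every \<open>k\<close> absorbs \<open>q\<close>; the products \<open>s\<^sub>k\<^sub>,\<^sub>j q\<^sub>k\<^sub>,\<^sub>j\<close>, and hence their
  degrees, do not change.\<close>

lemma Sigma_disj_add_sos:
  assumes "p \<in> Sigma_disj d e D" and "sos q" and "pdeg q \<le> d" and "d \<le> e"
  shows "p + q \<in> Sigma_disj d e D"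
proof -
  obtain s0 s where p: "pdeg p \<le> d" and
    cert: "\<forall>k<length D.
        sos (s0 k) \<and> (\<forall>j<length (D ! k). sos (s k j)) \<and>
        p = s0 k + (\<Sum>j<length (D ! k). s k j * D ! k ! j) \<and>
        pdeg (s0 k) \<le> e \<and> (\<forall>j<length (D ! k). pdeg (s k j * D ! k ! j) \<le> e)"
    using assms(1) unfolding Sigma_disj_def by blast
  have "sos (s0 k + q) \<and> (\<forall>j<length (D ! k). sos (s k j)) \<and>
      p + q = (s0 k + q) + (\<Sum>j<length (D ! k). s k j * D ! k ! j) \<and>
      pdeg (s0 k + q) \<le> e \<and> (\<forall>j<length (D ! k). pdeg (s k j * D ! k ! j) \<le> e)"
    if "k < length D" for k
  proof -
    have "p = s0 k + (\<Sum>j<length (D ! k). s k j * D ! k ! j)" using cert that by blast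
    then have "p + q = (s0 k + q) + (\<Sum>j<length (D ! k). s k j * D ! k ! j)"
      by (simp only: ac_simps)
    moreover have "pdeg (s0 k + q) \<le> e"
      using cert that assms(3,4) by (intro pdeg_add_le) auto
    ultimately show ?thesis
      using cert that assms(2) sos_add by blast
  qed
  moreover have "pdeg (p + q) \<le> d"
    using p assms(3) by (rule pdeg_add_le)
  ultimately show ?thesis
    unfolding Sigma_disj_def mem_Collect_eq
    by (intro conjI exI[of _ "\<lambda>k. s0 k + q"] exI[of _ s] allI impI) simp_all
qed

lemma zero_in_Sigma_disj: "0 \<in> Sigma_disj d e D"
  unfolding Sigma_disj_def
  by (intro CollectI conjI exI[of _ "\<lambda>_. 0"] exI[of _ "\<lambda>_ _. 0"]) (simp_all add: sos_zero pdeg_zero)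

lemma sos_in_Sigma_disj:
  assumes "sos q" and "pdeg q \<le> d" and "d \<le> e"
  shows "q \<in> Sigma_disj d e D"
  using Sigma_disj_add_sos[OF zero_in_Sigma_disj assms] by simp

section \<open>The hierarchy\<close>

lemma K_0: "K d D 0 = sos_forms d"
  by (auto simp: K_def Khat_def sos_forms_def)

lemma K_pos: "i \<ge> 1 \<Longrightarrow> K d D i = (\<Union>m\<in>{1..i}. Sigma_disj d d (D m)) \<inter> forms d"
  by (simp add: K_def Khat_def)

lemma K_nonneg:
  assumes "\<And>m. m \<ge> 1 \<Longrightarrow> algebraic_disjunction (D m)"
  shows "K d D i \<subseteq> nonneg_forms d"
proof (cases "i = 0")
  case True
  then show ?thesis by (auto simp: K_0 sos_forms_def nonneg_forms_def peval_sos_nonneg)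
next
  case False
  then show ?thesis
    using Sigma_disj_nonneg[OF assms] by (fastforce simp: K_pos nonneg_forms_def)
qed

text \<open>The step from \<open>0\<close> to \<open>1\<close> is special: \<open>K\<^sup>0\<close> consists of sums of squares, without reference to the
  disjunctions, and these belong to \<open>Sigma_disj d d\<close> of every one of them.\<close>

lemma K_subset_Suc: "K d D i \<subseteq> K d D (i + 1)"
proof (cases "i = 0")
  case True
  then show ?thesis
    by (auto simp: K_0 K_pos sos_forms_def intro: sos_in_Sigma_disj pdeg_le_of_form)
next
  case False
  then show ?thesis by (fastforce simp: K_pos)
qed

lemma K_add_sos_form:
  assumes "p \<in> K d D i" and "q \<in> sos_forms d"
  shows "p + q \<in> K d D i"
proof (cases "i = 0")
  case True
  then show ?thesis using assms by (auto simp: K_0 sos_forms_def sos_add forms_add)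
next
  case False
  then show ?thesis
    using assms
    by (fastforce simp: K_pos sos_forms_def forms_add pdeg_le_of_form intro: Sigma_disj_add_sos)
qed

theorem theorem10:
  fixes d :: nat
    and D :: "nat \<Rightarrow> 'n::finite rpoly list list"
  assumes "even d"
    and "\<And>m. m \<ge> 1 \<Longrightarrow> algebraic_disjunction (D m)"
    and "\<And>p. p \<in> forms d \<Longrightarrow> positive_definite p \<Longrightarrow>
           \<exists>m\<ge>1. p \<in> Sigma_disj d d (D m)"
    and "\<And>m Q. m \<ge> 1 \<Longrightarrow> Q \<in> set (D m) \<Longrightarrow>
           \<exists>q. set Q = {q} \<and> (\<exists>e\<le>d. q \<in> forms e)"
  shows "(\<forall>i. K d D i \<subseteq> nonneg_forms d) \<and>
         (\<exists>s \<in> K d D 0. positive_definite s \<and>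
            (\<forall>p. p \<in> forms d \<longrightarrow> positive_definite p \<longrightarrow> (\<exists>i. p \<in> K d D i)) \<and>
            (\<forall>i. K d D i \<subseteq> K d D (i + 1)) \<and>
            (\<forall>i. \<forall>p \<in> K d D i. \<forall>\<epsilon> \<in> {0..1}. p + pconst \<epsilon> * s \<in> K d D i))"
proof (intro conjI bexI[of _ "pure_power_sum d"] allI impI ballI)
  show sos_form: "pure_power_sum d \<in> K d D 0"
    using assms(1) by (simp add: K_0 sos_forms_def sos_pure_power_sum pure_power_sum_form)
  show "K d D i \<subseteq> nonneg_forms d" for i
    using assms(2) by (rule K_nonneg)
  show "positive_definite (pure_power_sum d :: 'n rpoly)"
    using assms(1) by (rule positive_definite_pure_power_sum)
  show "\<exists>i. p \<in> K d D i" if form: "p \<in> forms d" and pd: "positive_definite p" for p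
  proof -
    obtain m where "m \<ge> 1" and "p \<in> Sigma_disj d d (D m)"
      using assms(3)[OF form pd] by blast
    then have "p \<in> K d D m" using form by (auto simp: K_pos)
    then show ?thesis ..
  qed
  show "K d D i \<subseteq> K d D (i + 1)" for i
    by (rule K_subset_Suc)
  show "p + pconst \<epsilon> * pure_power_sum d \<in> K d D i"
    if "p \<in> K d D i" and "\<epsilon> \<in> {0..1}" for i p \<epsilon>
  proof (rule K_add_sos_form[OF that(1)])
    show "pconst \<epsilon> * pure_power_sum d \<in> (sos_forms d :: 'n rpoly set)"
      using sos_form that(2) by (simp add: K_0 sos_forms_def forms_pconst_mult sos_pconst_mult)
  qed
qed

end
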